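(* Let $f:\mathbb{R}^n\to\mathbb{R}$ be continuously differentiable with $\|\nabla f(x)-\nabla f(y)\|\le L\|x-y\|$ for all $x,y\in\mathbb{R}^n$, and suppose that $f$ is bounded from below. Let $\{x_k\}$ be the sequence produced by the Linesearch Algorithm Model (LAM), in either its standard or its new version. Given any $\epsilon\in(0,1)$, assume that $\bar\jmath+1$ is the first iteration such that $\|\nabla f(x_{\bar\jmath+1})\|\le\epsilon$, so that $\|\nabla f(x_k)\|>\epsilon$ for all $k=0,1,\dots,\bar\jmath$. Then the number $Nf$ of function evaluations required by LAM (over the iterations $k=0,\dots,\bar\jmath$) satisfies, in the worst case, $$Nf\le \mathcal{O}(\epsilon^{-2}).$$
   Context: Norms are Euclidean; $e_i$ (also written $e^i$) is the $i$-th coordinate vector of $\mathbb{R}^n$. The $\mathcal{O}(\epsilon^{-2})$ hides a constant that does not depend on $\epsilon$ (it may depend on $n$, $L$, $f$, and the data and parameters $x_0,\tilde\alpha_0^i,c,\theta,\gamma,\delta$). The function evaluations counted are the evaluations of $f$ at the trial points tested in Steps 2, 3 and 5 of the linesearch below. Linesearch Algorithm Model (LAM). Data: $c\in(0,1)$, $\theta\in(0,1)$, $x_0\in\mathbb{R}^n$, $\tilde\alpha_0^i>0$ for $i=1,\dots,n$, and $d_0^i=e^i$ for $i=1,\dots,n$. For $k=0,1,2,\dots$: set $y_k^1=x_k$. For $i=1,\dots,n$ in order: let $\bar\alpha_k^i=\max\{\tilde\alpha_k^i,\ c\max_{j=1,\dots,n}\tilde\alpha_k^j\}$; compute $\alpha$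 and $d$ by calling the procedure DF-Linesearch$(\bar\alpha_k^i,y_k^i,d_k^i;\alpha,d)$; if $\alpha=0$, set $\alpha_k^i=0$ and $\tilde\alpha_{k+1}^i=\theta\bar\alpha_k^i$; otherwise set $\alpha_k^i=\alpha$ and $\tilde\alpha_{k+1}^i=\alpha$; then set $d_{k+1}^i=d$ and $y_k^{i+1}=y_k^i+\alpha_k^i d_{k+1}^i$. After the loop over $i$, set $x_{k+1}=y_k^{n+1}$. DF-Linesearch$(\bar\alpha,y,d;\alpha,\hat d)$ takes inputs $\bar\alpha,y,d$, returns $(\alpha,\hat d)$, and has fixed parameters $\gamma>0$, $\delta\in(0,1)$. Step 1: set $\alpha=\bar\alpha$, $\hat d=d$. Step 2: if $f(y+\alpha\hat d)\le f(y)-\gamma\alpha^2$, go to Step 5. Step 3: if $f(y-\alpha\hat d)\le f(y)-\gamma\alpha^2$, set $\hat d=-d$ and go to Step 5. Step 4: set $\alpha=0$ and return $(0,\hat d)$. Step 5: while the extrapolation condition (below) holds, replace $\alpha$ by $\alpha/\delta$. Step 6: return $(\alpha,\hat d)$. The extrapolation condition is: - standard DF-Linesearch: $f\left(y+\frac{\alpha}{\delta}\hat d\right)\le f(y)-\gamma\left(\frac{\alpha}{\delta}\right)^2$; - new DF-Linesearch: $f\left(y+\frac{\alpha}{\delta}\hat d\right)\le f(y+\alpha\hat d)-\gamma\left(\left(\frac1\delta-1\right)\alpha\right)^2$. The standard LAM always uses the standard DF-Linesearch, and the new LAM always uses the new DF-Linesearch. *)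

theory Defs
  imports "HOL-Analysis.Analysis" "HOL-Library.While_Combinator"
begin

datatype df_version = Standard | New

fun extrapolates ::
  "df_version \<Rightarrow> (real ^ 'n \<Rightarrow> real) \<Rightarrow> real \<Rightarrow> real \<Rightarrow> real ^ 'n \<Rightarrow> real ^ 'n \<Rightarrow> real \<Rightarrow> bool"
where
  "extrapolates Standard f \<gamma> \<delta> y d \<alpha> \<longleftrightarrow>
     f (y + (\<alpha> / \<delta>) *\<^sub>R d) \<le> f y - \<gamma> * (\<alpha> / \<delta>)\<^sup>2"
| "extrapolates New f \<gamma> \<delta> y d \<alpha> \<longleftrightarrow>
     f (y + (\<alpha> / \<delta>) *\<^sub>R d) \<le> f (y + \<alpha> *\<^sub>R d) - \<gamma> * ((1 / \<delta> - 1) * \<alpha>)\<^sup>2"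

text \<open>
  Returns the final step and the number of trial points \<open>y + (\<alpha> / \<delta>) *\<^sub>R d\<close> tested. The loop
  counts the successful tests; the additional one is the failed test that ends the loop. If the loop
  diverges, \<^const>\<open>while\<close> yields an unspecified value.
\<close>
definition extrapolation ::
  "df_version \<Rightarrow> (real ^ 'n \<Rightarrow> real) \<Rightarrow> real \<Rightarrow> real \<Rightarrow> real ^ 'n \<Rightarrow> real ^ 'n \<Rightarrow> real \<Rightarrow> real \<times> nat"
where
  "extrapolation ver f \<gamma> \<delta> y d \<alpha>\<^sub>0 =
     (let (\<alpha>, m) = while (\<lambda>(\<alpha>, m). extrapolates ver f \<gamma> \<delta> y d \<alpha>)
                         (\<lambda>(\<alpha>, m). (\<alpha> / \<delta>, Suc m)) (\<alpha>\<^sub>0, 0)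
      in (\<alpha>, Suc m))"

text \<open>
  Returns the step, the (possibly reversed) direction, and the number of trial points at which
  \<open>f\<close> is evaluated; the value of \<open>f\<close> at the base point \<open>y\<close> is not counted.
\<close>
definition df_linesearch ::
  "df_version \<Rightarrow> (real ^ 'n \<Rightarrow> real) \<Rightarrow> real \<Rightarrow> real \<Rightarrow> real \<Rightarrow> real ^ 'n \<Rightarrow> real ^ 'n
    \<Rightarrow> real \<times> (real ^ 'n) \<times> nat"
where
  "df_linesearch ver f \<gamma> \<delta> \<alpha>\<^sub>0 y d =
     (if f (y + \<alpha>\<^sub>0 *\<^sub>R d) \<le> f y - \<gamma> * \<alpha>\<^sub>0\<^sup>2 then
        let (\<alpha>, m) = extrapolation ver f \<gamma> \<delta> y d \<alpha>\<^sub>0 in (\<alpha>, d, 1 + m)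
      else if f (y - \<alpha>\<^sub>0 *\<^sub>R d) \<le> f y - \<gamma> * \<alpha>\<^sub>0\<^sup>2 then
        let (\<alpha>, m) = extrapolation ver f \<gamma> \<delta> y (- d) \<alpha>\<^sub>0 in (\<alpha>, - d, 2 + m)
      else (0, d, 2))"

definition initial_step :: "nat \<Rightarrow> real \<Rightarrow> (nat \<Rightarrow> real) \<Rightarrow> nat \<Rightarrow> real" where
  "initial_step n c t i = max (t i) (c * Max (t ` {1..n}))"

text \<open>
  The sequences produced by the Linesearch Algorithm Model: \<open>x k\<close> are the iterates, \<open>t k i\<close> is
  \<open>\<alpha>\<close>-tilde, \<open>a k i\<close> the step, \<open>d k i\<close> the direction, \<open>y k i\<close> the intermediate point, and \<open>N k i\<close>
  the number of function evaluations made by the linesearch call for direction \<open>i\<close> in iteration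
  \<open>k\<close>. Inner indices range over \<open>{1..n}\<close> (\<open>{1..n + 1}\<close> for \<open>y\<close>) with \<open>n = CARD('n)\<close>; \<open>ix\<close> assigns
  the index \<open>i\<close> to a coordinate of \<open>real ^ 'n\<close>.
\<close>
definition lam_run ::
  "df_version \<Rightarrow> (real ^ 'n \<Rightarrow> real) \<Rightarrow> real \<Rightarrow> real \<Rightarrow> real \<Rightarrow> real \<Rightarrow> (nat \<Rightarrow> 'n)
    \<Rightarrow> real ^ 'n \<Rightarrow> (nat \<Rightarrow> real)
    \<Rightarrow> (nat \<Rightarrow> real ^ 'n) \<Rightarrow> (nat \<Rightarrow> nat \<Rightarrow> real) \<Rightarrow> (nat \<Rightarrow> nat \<Rightarrow> real)
    \<Rightarrow> (nat \<Rightarrow> nat \<Rightarrow> real ^ 'n) \<Rightarrow> (nat \<Rightarrow> nat \<Rightarrow> real ^ 'n) \<Rightarrow> (nat \<Rightarrow> nat \<Rightarrow> nat) \<Rightarrow> bool"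
where
  "lam_run ver f \<gamma> \<delta> c \<theta> ix x\<^sub>0 t\<^sub>0 x t a d y N \<longleftrightarrow>
     (let n = CARD('n) in
        x 0 = x\<^sub>0
      \<and> (\<forall>i\<in>{1..n}. t 0 i = t\<^sub>0 i \<and> d 0 i = axis (ix i) 1)
      \<and> (\<forall>k. y k 1 = x k
           \<and> (\<forall>i\<in>{1..n}.
                 (a k i, d (Suc k) i, N k i) =
                    df_linesearch ver f \<gamma> \<delta> (initial_step n c (t k) i) (y k i) (d k i)
               \<and> t (Suc k) i = (if a k i = 0 then \<theta> * initial_step n c (t k) i else a k i)
               \<and> y k (Suc i) = y k i + a k i *\<^sub>R d (Suc k) i)
           \<and> x (Suc k) = y k (Suc n)))"

end

theory Submission
  imports Defs
begin

text \<open>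
  Write \<open>T\<^sub>k\<close> for the largest tentative step at the start of iteration \<open>k\<close>. The bound follows from
  one potential function, \<open>\<Phi>\<^sub>k = f (x\<^sub>k) + \<rho>/2 T\<^sub>k\<^sup>2\<close> with \<open>\<rho> = \<gamma> (1 - \<delta>)\<^sup>2\<close>, whose decrease pays for the
  evaluations of an iteration.

  In both versions, a linesearch that accepts the step \<open>\<alpha>\<close> decreases \<open>f\<close> by at least \<open>\<rho> \<alpha>\<^sup>2\<close>, so an
  iteration decreases \<open>f\<close> by \<open>\<rho>\<close> times the sum of the squared steps. The tentative step after a call
  is either \<open>\<theta>\<close> times the initial one, hence at most \<open>\<theta> T\<^sub>k\<close>, or the accepted step; so \<open>T\<^sup>2\<close> can grow
  only by what the accepted steps allow, and otherwise contracts by \<open>\<theta>\<^sup>2\<close>. Together,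
  \<open>\<Phi>\<^sub>k - \<Phi>\<^sub>k\<^sub>+\<^sub>1\<close> is at least \<open>\<rho>/2\<close> times \<open>(1 - \<theta>\<^sup>2) T\<^sub>k\<^sup>2\<close> plus the sum of the squared steps.
  The first summand pays for the constantly many tests that each call makes anyway. The second pays
  for the extrapolations: all initial steps are at least \<open>c T\<^sub>k\<close>, and \<open>m\<close> extrapolations multiply the
  step by \<open>\<delta>\<close> to the power \<open>-m\<close>, so its square is at least \<open>m T\<^sub>k\<^sup>2\<close> times a constant. Hence \<open>T\<^sub>k\<^sup>2\<close> times the
  number of evaluations in iteration \<open>k\<close> is at most a constant times \<open>\<Phi>\<^sub>k - \<Phi>\<^sub>k\<^sub>+\<^sub>1\<close>
  (\<open>potential_decrease\<close>); as \<open>\<Phi>\<close> is bounded below, the sum over all \<open>k\<close> is bounded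
  (\<open>weighted_evaluations_bounded\<close>).

  It remains to bound \<open>T\<^sub>k\<close> below by a multiple of \<open>\<epsilon>\<close>. Every linesearch ends with failed tests, and a
  failed test at distance \<open>s\<close> shows, by the Lipschitz condition, that the slope is at most of order
  \<open>s\<close>. As every coordinate direction is searched in every iteration, the gradient at \<open>x\<^sub>k\<close> is at most a
  constant times \<open>T\<^sub>k\<^sub>+\<^sub>1\<close> (\<open>gradient_le_next_step\<close>). A gradient norm above \<open>\<epsilon>\<close> therefore keeps the next
  \<open>T\<close> above a multiple of \<open>\<epsilon>\<close>, and \<open>T\<^sub>0\<close> is a positive constant.
\<close>

section \<open>A single linesearch\<close>

text \<open>
  Bernoulli's inequality. It converts the squared length of an extrapolated step into a count of
  extrapolations, both for termination and for the evaluation count.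
\<close>
lemma geometric_growth_linear_bound:
  fixes \<delta> :: real
  assumes "0 < \<delta>" "\<delta> < 1"
  shows "real m * (1 / \<delta> - 1) \<le> ((1 / \<delta>) ^ m)\<^sup>2"
proof -
  have "1 + real m * (1 / \<delta> - 1) \<le> (1 + (1 / \<delta> - 1)) ^ m"
    using assms by (intro Bernoulli_inequality) (simp add: field_simps)
  then have "real m * (1 / \<delta> - 1) \<le> (1 / \<delta>) ^ m"
    by simp
  also have "\<dots> \<le> ((1 / \<delta>) ^ m)\<^sup>2"
  proof -
    have "1 \<le> (1 / \<delta>) ^ m"
      using assms by (intro one_le_power) (simp add: field_simps)
    then show ?thesis
      by (simp add: self_le_power)
  qed
  finally show ?thesis .
qed

locale smooth_linesearch =
  fixes f :: "real ^ 'n \<Rightarrow> real" and gradf :: "real ^ 'n \<Rightarrow> real ^ 'n"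
    and L \<gamma> \<delta> :: real and ver :: df_version
  assumes grad: "\<And>z. GDERIV f z :> gradf z"
    and grad_lipschitz: "\<And>u v. norm (gradf u - gradf v) \<le> L * norm (u - v)"
    and bounded_below: "bdd_below (range f)"
    and gamma: "0 < \<gamma>"
    and delta: "0 < \<delta>" "\<delta> < 1"
begin

text \<open>
  The factor \<open>(1 - \<delta>)\<^sup>2\<close> comes from the new version, which guarantees only the sum of the squared
  increments. The last increment of an extrapolated step \<open>\<alpha>\<close> is \<open>(1 - \<delta>) \<alpha>\<close>, so \<open>\<rho> \<alpha>\<^sup>2\<close> is a decrease that both
  versions achieve.
\<close>
definition \<rho> :: real where "\<rho> = \<gamma> * (1 - \<delta>)\<^sup>2"

lemma rho_pos: "0 < \<rho>"
  using gamma delta by (simp add: \<rho>_def)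

lemma L_nonneg: "0 \<le> L"
proof -
  have "0 \<le> L * norm (axis undefined 1 - 0 :: real ^ 'n)"
    using grad_lipschitz order_trans norm_ge_zero by blast
  then show ?thesis by simp
qed

text \<open>
  The mean value theorem along the segment suffices; the sharper constant \<open>L / 2\<close> would only change
  the hidden constant of the complexity bound.
\<close>
lemma first_order_model:
  assumes "0 < s" "norm u = 1"
  shows "\<bar>f (z + s *\<^sub>R u) - f z - s * (gradf z \<bullet> u)\<bar> \<le> L * s\<^sup>2"
proof -
  have "((\<lambda>r. f (z + r *\<^sub>R u)) has_real_derivative gradf (z + r *\<^sub>R u) \<bullet> u) (at r)" for r
  proof -
    have "((\<lambda>r. z + r *\<^sub>R u) has_derivative (\<lambda>h. h *\<^sub>R u)) (at r)"
      by (auto intro!: derivative_eq_intros)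
    from has_derivative_compose[OF this grad[of "z + r *\<^sub>R u", unfolded gderiv_def]]
    show ?thesis
      by (simp add: has_field_derivative_def inner_commute mult_commute_abs)
  qed
  from MVT2[OF assms(1), of "\<lambda>r. f (z + r *\<^sub>R u)", OF this]
  obtain r where r: "0 < r" "r < s"
    and eq: "f (z + s *\<^sub>R u) - f z = s * (gradf (z + r *\<^sub>R u) \<bullet> u)"
    by auto
  have "\<bar>(gradf (z + r *\<^sub>R u) - gradf z) \<bullet> u\<bar> \<le> norm (gradf (z + r *\<^sub>R u) - gradf z)"
    using Cauchy_Schwarz_ineq2[of _ u] assms(2) by (metis mult.right_neutral)
  also have "\<dots> \<le> L * r"
    using grad_lipschitz[of "z + r *\<^sub>R u" z] assms(2) r by simp
  also have "\<dots> \<le> L * s"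
    using r L_nonneg by (intro mult_left_mono) auto
  finally have "s * \<bar>(gradf (z + r *\<^sub>R u) - gradf z) \<bullet> u\<bar> \<le> s * (L * s)"
    using assms(1) by (intro mult_left_mono) auto
  moreover have "f (z + s *\<^sub>R u) - f z - s * (gradf z \<bullet> u) = s * ((gradf (z + r *\<^sub>R u) - gradf z) \<bullet> u)"
    unfolding eq by (simp add: algebra_simps)
  ultimately show ?thesis
    using assms(1) by (simp add: abs_mult power2_eq_square mult.left_commute)
qed

lemma failed_trial_slope:
  assumes "0 < s" "norm u = 1" "f z - \<gamma> * s\<^sup>2 < f (z + s *\<^sub>R u)"
  shows "- ((\<gamma> + L) * s) \<le> gradf z \<bullet> u"
proof -
  have "- ((\<gamma> + L) * s) * s \<le> (gradf z \<bullet> u) * s"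
    using first_order_model[OF assms(1,2), of z] assms(3)
    by (simp add: algebra_simps power2_eq_square abs_le_iff)
  then show ?thesis
    using assms(1) mult_le_cancel_right_pos by blast
qed

text \<open>
  This makes \<open>\<rho> \<alpha>\<^sup>2\<close> an invariant decrease of the extrapolation loop. In the new version the increment
  from \<open>\<alpha>\<close> to \<open>\<alpha> / \<delta>\<close> alone accounts for all of it.
\<close>
lemma extrapolation_step_decrease:
  assumes "f (z + \<alpha> *\<^sub>R u) \<le> f z - \<rho> * \<alpha>\<^sup>2" "extrapolates ver f \<gamma> \<delta> z u \<alpha>"
  shows "f (z + (\<alpha> / \<delta>) *\<^sub>R u) \<le> f z - \<rho> * (\<alpha> / \<delta>)\<^sup>2"
proof (cases ver)
  case Standard
  have "\<rho> \<le> \<gamma> * 1"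
    unfolding \<rho>_def using gamma delta by (intro mult_left_mono power_le_one) auto
  then have "\<rho> * (\<alpha> / \<delta>)\<^sup>2 \<le> \<gamma> * (\<alpha> / \<delta>)\<^sup>2"
    by (intro mult_right_mono) auto
  then show ?thesis
    using assms(2) Standard by simp
next
  case New
  have "0 \<le> \<rho> * \<alpha>\<^sup>2"
    using rho_pos by simp
  moreover have "\<gamma> * ((1 / \<delta> - 1) * \<alpha>)\<^sup>2 = \<rho> * (\<alpha> / \<delta>)\<^sup>2"
    unfolding \<rho>_def using delta by (simp add: field_simps power2_eq_square)
  ultimately show ?thesis
    using assms New by simp
qed

text \<open>
  The loop ends because \<open>f\<close> is bounded below: \<open>m\<close> extrapolations decrease \<open>f\<close> by a quantity that grows
  at least linearly in \<open>m\<close>. Termination is what makes the value of \<^const>\<open>while\<close> meaningful.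
\<close>
lemma extrapolation_terminates:
  assumes "0 < \<alpha>\<^sub>0" "f (z + \<alpha>\<^sub>0 *\<^sub>R u) \<le> f z - \<gamma> * \<alpha>\<^sub>0\<^sup>2"
  obtains m where
    "extrapolation ver f \<gamma> \<delta> z u \<alpha>\<^sub>0 = (\<alpha>\<^sub>0 * (1 / \<delta>) ^ m, Suc m)"
    "f (z + (\<alpha>\<^sub>0 * (1 / \<delta>) ^ m) *\<^sub>R u) \<le> f z - \<rho> * (\<alpha>\<^sub>0 * (1 / \<delta>) ^ m)\<^sup>2"
    "\<not> extrapolates ver f \<gamma> \<delta> z u (\<alpha>\<^sub>0 * (1 / \<delta>) ^ m)"
proof -
  define I where "I = (\<lambda>(\<alpha>, m::nat). \<alpha> = \<alpha>\<^sub>0 * (1 / \<delta>) ^ m \<and> f (z + \<alpha> *\<^sub>R u) \<le> f z - \<rho> * \<alpha>\<^sup>2)"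
  obtain b where b: "\<And>w. b \<le> f w"
    using bounded_below by (auto simp: bdd_below_def)
  \<comment> \<open>the largest \<open>m\<close> for which a decrease of \<open>\<rho> \<alpha>\<^sub>0\<^sup>2 m (1/\<delta> - 1)\<close> stays above the lower bound \<open>b\<close>\<close>
  define B where "B = (f z - b) / (\<rho> * \<alpha>\<^sub>0\<^sup>2 * (1 / \<delta> - 1))"
  have kappa: "0 < 1 / \<delta> - 1"
    using delta by simp
  have bound: "real m \<le> B" if "I (\<alpha>, m)" for \<alpha> m
  proof -
    have "\<rho> * \<alpha>\<^sub>0\<^sup>2 * (real m * (1 / \<delta> - 1)) \<le> \<rho> * \<alpha>\<^sub>0\<^sup>2 * ((1 / \<delta>) ^ m)\<^sup>2"
      using geometric_growth_linear_bound[OF delta, of m] rho_pos by (intro mult_left_mono) auto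
    also have "\<dots> = \<rho> * \<alpha>\<^sup>2"
      using that by (simp add: I_def power_mult_distrib)
    also have "\<dots> \<le> f z - b"
      using that b[of "z + \<alpha> *\<^sub>R u"] unfolding I_def by auto
    finally show ?thesis
      unfolding B_def using rho_pos assms(1) kappa by (simp add: pos_le_divide_eq mult_ac)
  qed
  let ?E = "\<lambda>(\<alpha>, m::nat). extrapolates ver f \<gamma> \<delta> z u \<alpha>"
  let ?s = "\<lambda>(\<alpha>, m). (\<alpha> / \<delta>, Suc m)"
  let ?w = "while ?E ?s (\<alpha>\<^sub>0, 0)"
  have "I ?w \<and> \<not> ?E ?w"
  proof (rule while_rule[where P = I and r = "Wellfounded.measure (\<lambda>(\<alpha>, m). nat \<lceil>B\<rceil> + 1 - m)"])
    have "\<rho> \<le> \<gamma> * 1"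
      unfolding \<rho>_def using gamma delta by (intro mult_left_mono power_le_one) auto
    then have "\<rho> * \<alpha>\<^sub>0\<^sup>2 \<le> \<gamma> * \<alpha>\<^sub>0\<^sup>2"
      by (intro mult_right_mono) auto
    then show "I (\<alpha>\<^sub>0, 0)"
      using assms(2) by (simp add: I_def)
  next
    fix p assume "I p" "?E p"
    then show "I (?s p)"
      using extrapolation_step_decrease by (auto simp: I_def split: prod.splits)
  next
    fix p assume "I p" "?E p"
    moreover have "m \<le> nat \<lceil>B\<rceil>" if "I (\<alpha>, m)" for \<alpha> m
      using bound[OF that] by linarith
    ultimately show "(?s p, p) \<in> Wellfounded.measure (\<lambda>(\<alpha>, m). nat \<lceil>B\<rceil> + 1 - m)"
      by (fastforce simp: Suc_diff_le split: prod.splits)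
  qed auto
  then obtain \<alpha> m where "?w = (\<alpha>, m)" "I (\<alpha>, m)" "\<not> extrapolates ver f \<gamma> \<delta> z u \<alpha>"
    by (cases ?w) auto
  then show ?thesis
    by (intro that[of m]) (auto simp: extrapolation_def I_def)
qed

text \<open>
  All that is used about a call. After \<open>m\<close> extrapolations, at most two tests have found the
  direction and \<open>m + 1\<close> were made in the loop, the last one unsuccessful.
\<close>
lemma df_linesearch_cases:
  assumes "0 < \<alpha>\<^sub>0" "(\<alpha>, u', N) = df_linesearch ver f \<gamma> \<delta> \<alpha>\<^sub>0 z u"
  obtains (fail) "\<alpha> = 0" "u' = u" "N = 2"
      "f z - \<gamma> * \<alpha>\<^sub>0\<^sup>2 < f (z + \<alpha>\<^sub>0 *\<^sub>R u)" "f z - \<gamma> * \<alpha>\<^sub>0\<^sup>2 < f (z + \<alpha>\<^sub>0 *\<^sub>R (- u))"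
    | (success) m where "\<alpha> = \<alpha>\<^sub>0 * (1 / \<delta>) ^ m" "u' = u \<or> u' = - u" "N \<le> m + 3"
      "f (z + \<alpha> *\<^sub>R u') \<le> f z - \<rho> * \<alpha>\<^sup>2" "\<not> extrapolates ver f \<gamma> \<delta> z u' \<alpha>"
proof (cases "f (z + \<alpha>\<^sub>0 *\<^sub>R u) \<le> f z - \<gamma> * \<alpha>\<^sub>0\<^sup>2")
  case True
  from extrapolation_terminates[OF assms(1) True] obtain m where
    m: "extrapolation ver f \<gamma> \<delta> z u \<alpha>\<^sub>0 = (\<alpha>\<^sub>0 * (1 / \<delta>) ^ m, Suc m)"
    "f (z + (\<alpha>\<^sub>0 * (1 / \<delta>) ^ m) *\<^sub>R u) \<le> f z - \<rho> * (\<alpha>\<^sub>0 * (1 / \<delta>) ^ m)\<^sup>2"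
    "\<not> extrapolates ver f \<gamma> \<delta> z u (\<alpha>\<^sub>0 * (1 / \<delta>) ^ m)" .
  then show ?thesis
    using assms(2) True by (intro success[of m]) (simp_all add: df_linesearch_def)
next
  case F: False
  show ?thesis
  proof (cases "f (z - \<alpha>\<^sub>0 *\<^sub>R u) \<le> f z - \<gamma> * \<alpha>\<^sub>0\<^sup>2")
    case True
    then have "f (z + \<alpha>\<^sub>0 *\<^sub>R (- u)) \<le> f z - \<gamma> * \<alpha>\<^sub>0\<^sup>2"
      by simp
    from extrapolation_terminates[OF assms(1) this] obtain m where
      m: "extrapolation ver f \<gamma> \<delta> z (- u) \<alpha>\<^sub>0 = (\<alpha>\<^sub>0 * (1 / \<delta>) ^ m, Suc m)"
      "f (z + (\<alpha>\<^sub>0 * (1 / \<delta>) ^ m) *\<^sub>R (- u)) \<le> f z - \<rho> * (\<alpha>\<^sub>0 * (1 / \<delta>) ^ m)\<^sup>2"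
      "\<not> extrapolates ver f \<gamma> \<delta> z (- u) (\<alpha>\<^sub>0 * (1 / \<delta>) ^ m)" .
    then show ?thesis
      using assms(2) F True by (intro success[of m]) (simp_all add: df_linesearch_def)
  next
    case False
    then show ?thesis
      using assms(2) F by (intro fail) (simp_all add: df_linesearch_def)
  qed
qed

text \<open>
  The accepted step bounds the slope along \<open>u\<close> from above, since otherwise \<open>f\<close> would have increased
  along it; the failed extrapolation test bounds it from below.
\<close>
lemma final_step_slope:
  assumes "0 < \<alpha>" "norm u = 1" "f (z + \<alpha> *\<^sub>R u) \<le> f z" "\<not> extrapolates ver f \<gamma> \<delta> z u \<alpha>"
  shows "\<bar>gradf z \<bullet> u\<bar> \<le> (\<gamma> + L) / \<delta> * \<alpha>"
proof -
  have "(gradf z \<bullet> u) * \<alpha> \<le> (L * \<alpha>) * \<alpha>"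
    using first_order_model[OF assms(1,2), of z] assms(3)
    by (simp add: algebra_simps power2_eq_square abs_le_iff)
  then have "gradf z \<bullet> u \<le> L * \<alpha>"
    using assms(1) mult_le_cancel_right_pos by blast
  also have "\<dots> \<le> (\<gamma> + L) / \<delta> * \<alpha>"
  proof -
    have "L * \<delta> \<le> L"
      using L_nonneg delta by (simp add: mult_left_le)
    then have "L \<le> (\<gamma> + L) / \<delta>"
      using gamma delta by (simp add: pos_le_divide_eq)
    then show ?thesis
      using assms(1) by (intro mult_right_mono) auto
  qed
  finally have upper: "gradf z \<bullet> u \<le> (\<gamma> + L) / \<delta> * \<alpha>" .
  have lower: "- ((\<gamma> + L) / \<delta> * \<alpha>) \<le> gradf z \<bullet> u"
  proof (cases ver)
    case Standard
    then show ?thesis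
      using failed_trial_slope[of "\<alpha> / \<delta>" u z] assms delta by simp
  next
    case New
    \<comment> \<open>The failed test compares with the point reached, so it is a failed trial of step \<open>s\<close> from there;
      moving the slope back to \<open>z\<close> costs \<open>L * \<alpha>\<close>.\<close>
    define s where "s = (1 / \<delta> - 1) * \<alpha>"
    have "0 < s"
      unfolding s_def using delta assms(1) by simp
    have split: "z + (\<alpha> / \<delta>) *\<^sub>R u = (z + \<alpha> *\<^sub>R u) + s *\<^sub>R u"
      by (simp add: s_def algebra_simps)
    have "- ((\<gamma> + L) * s) \<le> gradf (z + \<alpha> *\<^sub>R u) \<bullet> u"
    proof (intro failed_trial_slope \<open>0 < s\<close> assms(2))
      show "f (z + \<alpha> *\<^sub>R u) - \<gamma> * s\<^sup>2 < f (z + \<alpha> *\<^sub>R u + s *\<^sub>R u)"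
        using assms(4) New by (simp add: split[symmetric]) (simp add: s_def)
    qed
    also have "\<dots> \<le> gradf z \<bullet> u + L * \<alpha>"
    proof -
      have "(gradf (z + \<alpha> *\<^sub>R u) - gradf z) \<bullet> u \<le> norm (gradf (z + \<alpha> *\<^sub>R u) - gradf z)"
        using norm_cauchy_schwarz[of _ u] assms(2) by (metis mult.right_neutral)
      also have "\<dots> \<le> L * \<alpha>"
        using grad_lipschitz[of "z + \<alpha> *\<^sub>R u" z] assms(1,2) by simp
      finally show ?thesis
        by (simp add: algebra_simps)
    qed
    finally have "- ((\<gamma> + L) * s) - L * \<alpha> \<le> gradf z \<bullet> u"
      by simp
    moreover have "(\<gamma> + L) * s + L * \<alpha> = (\<gamma> + L) / \<delta> * \<alpha> - \<gamma> * \<alpha>"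
      by (simp add: s_def algebra_simps add_divide_distrib)
    moreover have "0 < \<gamma> * \<alpha>"
      using gamma assms(1) by simp
    ultimately show ?thesis
      by linarith
  qed
  show ?thesis
    using upper lower by (simp add: abs_le_iff)
qed

end

section \<open>Steps and directions of a run\<close>

locale lam = smooth_linesearch f gradf L \<gamma> \<delta> ver
  for f :: "real ^ 'n \<Rightarrow> real" and gradf :: "real ^ 'n \<Rightarrow> real ^ 'n"
    and L \<gamma> \<delta> :: real and ver :: df_version +
  fixes c \<theta> :: real
    and ix :: "nat \<Rightarrow> 'n" and x\<^sub>0 :: "real ^ 'n" and t\<^sub>0 :: "nat \<Rightarrow> real"
    and x :: "nat \<Rightarrow> real ^ 'n" and t a :: "nat \<Rightarrow> nat \<Rightarrow> real"
    and d y :: "nat \<Rightarrow> nat \<Rightarrow> real ^ 'n" and N :: "nat \<Rightarrow> nat \<Rightarrow> nat"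
  assumes c: "0 < c" "c < 1"
    and theta: "0 < \<theta>" "\<theta> < 1"
    and ix: "bij_betw ix {1..CARD('n)} UNIV"
    and t0_pos: "\<And>i. i \<in> {1..CARD('n)} \<Longrightarrow> 0 < t\<^sub>0 i"
    and run: "lam_run ver f \<gamma> \<delta> c \<theta> ix x\<^sub>0 t\<^sub>0 x t a d y N"
begin

definition T :: "nat \<Rightarrow> real" where "T k = Max (t k ` {1..CARD('n)})"

definition s :: "nat \<Rightarrow> nat \<Rightarrow> real" where "s k i = initial_step CARD('n) c (t k) i"

lemma y_start: "y k 1 = x k" and y_end: "y k (Suc CARD('n)) = x (Suc k)"
  using run by (simp_all add: lam_run_def Let_def)

lemma call:
  assumes "i \<in> {1..CARD('n)}"
  shows "(a k i, d (Suc k) i, N k i) = df_linesearch ver f \<gamma> \<delta> (s k i) (y k i) (d k i)"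
    and "t (Suc k) i = (if a k i = 0 then \<theta> * s k i else a k i)"
    and "y k (Suc i) = y k i + a k i *\<^sub>R d (Suc k) i"
  using run assms by (simp_all add: lam_run_def Let_def s_def)

lemma t_le_T: "i \<in> {1..CARD('n)} \<Longrightarrow> t k i \<le> T k"
  unfolding T_def by (intro Max_ge) auto

lemma T_attained: obtains i where "i \<in> {1..CARD('n)}" "T k = t k i"
proof -
  have "{1..CARD('n)} \<noteq> {}"
    using zero_less_card_finite[where 'a = 'n] by (simp add: Suc_le_eq)
  then have "T k \<in> t k ` {1..CARD('n)}"
    unfolding T_def by (intro Max_in) auto
  then show ?thesis
    using that by blast
qed

lemma initial_step_lower: "c * T k \<le> s k i"
  by (simp add: s_def initial_step_def T_def)

text \<open>
  The claim on directions rests on the one on steps: the outcome of a call is known only for a positive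
  initial step, because the extrapolation from a step of length zero need not end.
\<close>
lemma steps_and_directions:
  shows "(\<forall>i\<in>{1..CARD('n)}. 0 < t k i) \<and> (\<forall>i\<in>{1..CARD('n)}. d k i = axis (ix i) 1 \<or> d k i = - axis (ix i) 1)"
proof (induction k)
  case 0
  then show ?case
    using run t0_pos by (simp add: lam_run_def Let_def)
next
  case (Suc k)
  have "0 < t (Suc k) i \<and> (d (Suc k) i = axis (ix i) 1 \<or> d (Suc k) i = - axis (ix i) 1)"
    if i: "i \<in> {1..CARD('n)}" for i
  proof -
    have "0 < s k i"
      using Suc i by (auto simp: s_def initial_step_def less_max_iff_disj)
    from df_linesearch_cases[OF this call(1)[OF i]] show ?thesis
      using Suc i call(2)[OF i, of k] \<open>0 < s k i\<close> theta delta by cases auto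
  qed
  then show ?case
    by blast
qed

lemma t_pos: "i \<in> {1..CARD('n)} \<Longrightarrow> 0 < t k i"
  using steps_and_directions by blast

lemma direction: "i \<in> {1..CARD('n)} \<Longrightarrow> d k i = axis (ix i) 1 \<or> d k i = - axis (ix i) 1"
  using steps_and_directions by blast

lemma norm_direction: "i \<in> {1..CARD('n)} \<Longrightarrow> norm (d k i) = 1"
  using direction[of i k] by (auto simp: norm_axis_1)

lemma abs_inner_direction: "i \<in> {1..CARD('n)} \<Longrightarrow> \<bar>v \<bullet> d k i\<bar> = \<bar>v $ ix i\<bar>"
  using direction[of i k] by (auto simp: inner_axis)

lemma T_pos: "0 < T k"
  using T_attained[of k] t_pos by metis

lemma initial_step_pos: "0 < s k i"
  using initial_step_lower[of k i] T_pos[of k] c by (metis less_le_trans mult_pos_pos)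

lemma initial_step_upper: "i \<in> {1..CARD('n)} \<Longrightarrow> s k i \<le> T k"
  using t_le_T[of i k] T_pos[of k] c by (simp add: s_def initial_step_def T_def mult_left_le_one_le)

lemma call_cases:
  assumes "i \<in> {1..CARD('n)}"
  obtains (fail) "a k i = 0" "d (Suc k) i = d k i" "N k i = 2" "t (Suc k) i = \<theta> * s k i"
      "f (y k i) - \<gamma> * (s k i)\<^sup>2 < f (y k i + s k i *\<^sub>R d k i)"
      "f (y k i) - \<gamma> * (s k i)\<^sup>2 < f (y k i + s k i *\<^sub>R (- d k i))"
    | (success) m where "0 < a k i" "a k i = s k i * (1 / \<delta>) ^ m" "N k i \<le> m + 3"
      "t (Suc k) i = a k i"
      "f (y k (Suc i)) \<le> f (y k i) - \<rho> * (a k i)\<^sup>2"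
      "\<not> extrapolates ver f \<gamma> \<delta> (y k i) (d (Suc k) i) (a k i)"
  using initial_step_pos[of k i] call(1)[OF assms, of k]
proof (cases rule: df_linesearch_cases)
  case fail
  then show ?thesis
    using that(1) call(2)[OF assms, of k] by simp
next
  case (success m)
  then have "0 < a k i"
    using initial_step_pos[of k i] delta by simp
  with success call(2,3)[OF assms, of k] show ?thesis
    using delta by (intro that(2)[of m]) simp_all
qed

lemma step_nonneg: "i \<in> {1..CARD('n)} \<Longrightarrow> 0 \<le> a k i"
  by (rule call_cases[of i k]) auto

lemma step_le_T: "i \<in> {1..CARD('n)} \<Longrightarrow> a k i \<le> T (Suc k)"
  by (rule call_cases[of i k]) (use t_le_T[of i "Suc k"] T_pos[of "Suc k"] in auto)

lemma call_decrease:
  assumes "i \<in> {1..CARD('n)}"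
  shows "f (y k (Suc i)) \<le> f (y k i) - \<rho> * (a k i)\<^sup>2"
  using assms by (cases rule: call_cases[of i k]) (use call(3)[OF assms, of k] in simp_all)

section \<open>The potential pays for the evaluations\<close>

lemma iteration_decrease: "f (x (Suc k)) \<le> f (x k) - \<rho> * (\<Sum>i=1..CARD('n). (a k i)\<^sup>2)"
proof -
  have "f (y k (Suc m)) \<le> f (x k) - \<rho> * (\<Sum>i=1..m. (a k i)\<^sup>2)" if "m \<le> CARD('n)" for m
    using that
  proof (induction m)
    case 0
    then show ?case
      using y_start[of k] by simp
  next
    case (Suc m)
    then show ?case
      using call_decrease[of "Suc m" k] by (simp add: algebra_simps)
  qed
  from this[OF order_refl] show ?thesis
    by (simp add: y_end)
qed

text \<open>
  The largest new tentative step was produced by one call: a failed one contracts by \<open>\<theta>\<close>, a successful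
  one contributes its step, which is one of the summands.
\<close>
lemma T_Suc_square: "(T (Suc k))\<^sup>2 \<le> \<theta>\<^sup>2 * (T k)\<^sup>2 + (\<Sum>i=1..CARD('n). (a k i)\<^sup>2)"
proof -
  obtain i where i: "i \<in> {1..CARD('n)}" "T (Suc k) = t (Suc k) i"
    by (rule T_attained)
  have sum: "(a k i)\<^sup>2 \<le> (\<Sum>i=1..CARD('n). (a k i)\<^sup>2)"
    using i(1) by (intro member_le_sum) auto
  show ?thesis
    using i(1)
  proof (cases rule: call_cases[of i k])
    case fail
    have "\<theta> * s k i \<le> \<theta> * T k"
      using initial_step_upper[OF i(1), of k] theta by (intro mult_left_mono) auto
    then have "(\<theta> * s k i)\<^sup>2 \<le> (\<theta> * T k)\<^sup>2"
      using initial_step_pos[of k i] theta by (intro power_mono) auto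
    moreover have "0 \<le> (\<Sum>i=1..CARD('n). (a k i)\<^sup>2)"
      by (intro sum_nonneg) auto
    ultimately show ?thesis
      using fail i(2) by (simp add: power_mult_distrib)
  next
    case success
    have "0 \<le> \<theta>\<^sup>2 * (T k)\<^sup>2"
      by simp
    then show ?thesis
      unfolding i(2) success(4) using sum by linarith
  qed
qed

text \<open>
  Here the safeguard \<open>c\<close> of the algorithm matters: since no initial step is below \<open>c * T k\<close>, the
  extrapolations of any direction are paid for at the scale of the largest tentative step.
\<close>
lemma call_evaluations:
  assumes "i \<in> {1..CARD('n)}"
  shows "(T k)\<^sup>2 * N k i \<le> 3 * (T k)\<^sup>2 + (a k i)\<^sup>2 / (c\<^sup>2 * (1 / \<delta> - 1))"
  using assms
proof (cases rule: call_cases[of i k])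
  case fail
  then show ?thesis
    by simp
next
  case (success m)
  have kappa: "0 < 1 / \<delta> - 1"
    using delta by simp
  have "(c * T k)\<^sup>2 * (real m * (1 / \<delta> - 1)) \<le> (s k i)\<^sup>2 * ((1 / \<delta>) ^ m)\<^sup>2"
    using geometric_growth_linear_bound[OF delta, of m] initial_step_lower[of k i] T_pos[of k] c kappa
    by (intro mult_mono power_mono) auto
  also have "\<dots> = (a k i)\<^sup>2"
    using success by (simp add: power_mult_distrib)
  finally have "(T k)\<^sup>2 * real m * (c\<^sup>2 * (1 / \<delta> - 1)) \<le> (a k i)\<^sup>2"
    by (simp add: power_mult_distrib mult_ac)
  then have "(T k)\<^sup>2 * real m \<le> (a k i)\<^sup>2 / (c\<^sup>2 * (1 / \<delta> - 1))"
    using kappa c by (subst pos_le_divide_eq) auto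
  moreover have "(T k)\<^sup>2 * N k i \<le> (T k)\<^sup>2 * (real m + 3)"
    using success(3) by (intro mult_left_mono) auto
  ultimately show ?thesis
    by (simp add: algebra_simps)
qed

text \<open>
  A common price for the two kinds of evaluations: the first summand covers the at most three per call
  that are not successful extrapolations, the second one covers the successful extrapolations.
\<close>
definition M :: real where "M = 3 * real CARD('n) / (1 - \<theta>\<^sup>2) + 1 / (c\<^sup>2 * (1 / \<delta> - 1))"

lemma theta_square: "0 < 1 - \<theta>\<^sup>2"
  using theta by (simp add: power_less_one_iff)

lemma M_pos: "0 < M"
proof -
  have "0 < 3 * real CARD('n) / (1 - \<theta>\<^sup>2)"
    using theta_square by (intro divide_pos_pos) auto
  moreover have "0 < 1 / (c\<^sup>2 * (1 / \<delta> - 1))"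
    using c delta by simp
  ultimately show ?thesis
    unfolding M_def by (rule add_pos_pos)
qed

lemma iteration_evaluations:
  "(T k)\<^sup>2 * (\<Sum>i=1..CARD('n). N k i) \<le> M * ((1 - \<theta>\<^sup>2) * (T k)\<^sup>2 + (\<Sum>i=1..CARD('n). (a k i)\<^sup>2))"
proof -
  let ?A = "\<Sum>i=1..CARD('n). (a k i)\<^sup>2" and ?p = "3 * real CARD('n) / (1 - \<theta>\<^sup>2)" and ?q = "1 / (c\<^sup>2 * (1 / \<delta> - 1))"
  have "(T k)\<^sup>2 * (\<Sum>i=1..CARD('n). N k i) = (\<Sum>i=1..CARD('n). (T k)\<^sup>2 * N k i)"
    by (simp add: sum_distrib_left)
  also have "\<dots> \<le> (\<Sum>i=1..CARD('n). 3 * (T k)\<^sup>2 + (a k i)\<^sup>2 / (c\<^sup>2 * (1 / \<delta> - 1)))"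
    by (intro sum_mono call_evaluations)
  also have "\<dots> = ?p * ((1 - \<theta>\<^sup>2) * (T k)\<^sup>2) + ?q * ?A"
    using theta_square by (simp add: sum.distrib sum_divide_distrib)
  also have "\<dots> \<le> M * ((1 - \<theta>\<^sup>2) * (T k)\<^sup>2) + M * ?A"
  proof (intro add_mono mult_right_mono)
    show "?p \<le> M" "?q \<le> M"
      unfolding M_def using theta_square c delta by simp_all
    show "0 \<le> (1 - \<theta>\<^sup>2) * (T k)\<^sup>2"
      using theta_square by simp
    show "0 \<le> ?A"
      by (intro sum_nonneg) auto
  qed
  finally show ?thesis
    by (simp add: algebra_simps)
qed

text \<open>
  The values of \<open>f\<close> alone do not decrease in iterations where all calls fail, but then \<open>T\<close> contracts.
  The weight \<open>\<rho> / 2\<close> keeps half of the decrease of \<open>f\<close> in reserve after it has paid for a possible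
  growth of \<open>T\<close>.
\<close>
definition \<Phi> :: "nat \<Rightarrow> real" where "\<Phi> k = f (x k) + \<rho> / 2 * (T k)\<^sup>2"

lemma potential_decrease:
  "\<rho> / (2 * M) * ((T k)\<^sup>2 * (\<Sum>i=1..CARD('n). N k i)) \<le> \<Phi> k - \<Phi> (Suc k)"
proof -
  let ?A = "\<Sum>i=1..CARD('n). (a k i)\<^sup>2"
  have "\<rho> / (2 * M) * ((T k)\<^sup>2 * (\<Sum>i=1..CARD('n). N k i))
      \<le> \<rho> / (2 * M) * (M * ((1 - \<theta>\<^sup>2) * (T k)\<^sup>2 + ?A))"
    using iteration_evaluations[of k] rho_pos M_pos by (intro mult_left_mono) auto
  also have "\<dots> = \<rho> / 2 * ((1 - \<theta>\<^sup>2) * (T k)\<^sup>2 + ?A)"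
    using M_pos by simp
  also have "\<dots> \<le> \<Phi> k - \<Phi> (Suc k)"
  proof -
    have "\<rho> / 2 * (T (Suc k))\<^sup>2 \<le> \<rho> / 2 * (\<theta>\<^sup>2 * (T k)\<^sup>2 + ?A)"
      using T_Suc_square[of k] rho_pos by (intro mult_left_mono) auto
    then show ?thesis
      using iteration_decrease[of k] unfolding \<Phi>_def by (simp add: algebra_simps)
  qed
  finally show ?thesis .
qed

lemma weighted_evaluations_bounded:
  obtains D where "\<And>j. (\<Sum>k\<le>j. (T k)\<^sup>2 * (\<Sum>i=1..CARD('n). N k i)) \<le> D"
proof -
  obtain b where b: "\<And>w. b \<le> f w"
    using bounded_below by (auto simp: bdd_below_def)
  have "(\<Sum>k\<le>j. (T k)\<^sup>2 * (\<Sum>i=1..CARD('n). N k i)) \<le> (\<Phi> 0 - b) / (\<rho> / (2 * M))" for j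
  proof -
    have "\<rho> / (2 * M) * (\<Sum>k\<le>j. (T k)\<^sup>2 * (\<Sum>i=1..CARD('n). N k i)) \<le> (\<Sum>k\<le>j. \<Phi> k - \<Phi> (Suc k))"
      unfolding sum_distrib_left by (intro sum_mono potential_decrease)
    also have "\<dots> = \<Phi> 0 - \<Phi> (Suc j)"
      by (rule sum_telescope)
    also have "\<dots> \<le> \<Phi> 0 - b"
    proof -
      have "0 \<le> \<rho> / 2 * (T (Suc j))\<^sup>2"
        using rho_pos by simp
      then show ?thesis
        using b[of "x (Suc j)"] unfolding \<Phi>_def by linarith
    qed
    finally show ?thesis
      by (subst pos_le_divide_eq) (use rho_pos M_pos in \<open>auto simp: mult.commute\<close>)
  qed
  then show ?thesis
    using that by blast
qed

section \<open>A small tentative step forces a small gradient\<close>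

text \<open>
  The outcome of a call is visible in its next tentative step, which is \<open>\<theta>\<close> times the failed step or
  the accepted step itself; this is where the factor \<open>1 / \<theta>\<close> comes from.
\<close>
lemma call_slope:
  assumes "i \<in> {1..CARD('n)}"
  shows "\<bar>gradf (y k i) $ ix i\<bar> \<le> (\<gamma> + L) / (\<delta> * \<theta>) * T (Suc k)"
proof -
  have K: "0 \<le> (\<gamma> + L) / \<delta>"
    using gamma delta L_nonneg by simp
  have "\<bar>gradf (y k i) $ ix i\<bar> \<le> (\<gamma> + L) / \<delta> * (t (Suc k) i / \<theta>)"
    using assms
  proof (cases rule: call_cases[of i k])
    case fail
    have "\<bar>gradf (y k i) \<bullet> d k i\<bar> \<le> (\<gamma> + L) * s k i"
      using failed_trial_slope[OF initial_step_pos norm_direction[OF assms] fail(5)]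
        failed_trial_slope[OF initial_step_pos _ fail(6)] norm_direction[OF assms, of k]
      by (simp add: abs_le_iff)
    also have "\<dots> \<le> (\<gamma> + L) / \<delta> * s k i"
    proof -
      have "\<gamma> + L \<le> (\<gamma> + L) / \<delta>"
        using gamma delta L_nonneg by (simp add: pos_le_divide_eq mult_left_le)
      then show ?thesis
        using initial_step_pos[of k i] by (intro mult_right_mono) auto
    qed
    finally show ?thesis
      using fail(4) theta abs_inner_direction[OF assms, of "gradf (y k i)" k] by simp
  next
    case (success m)
    have "0 \<le> \<rho> * (a k i)\<^sup>2"
      using rho_pos by simp
    then have "f (y k i + a k i *\<^sub>R d (Suc k) i) \<le> f (y k i)"
      using success(5) call(3)[OF assms, of k] by simp
    from final_step_slope[OF success(1) norm_direction[OF assms] this success(6)]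
    have "\<bar>gradf (y k i) $ ix i\<bar> \<le> (\<gamma> + L) / \<delta> * t (Suc k) i"
      using success(4) abs_inner_direction[OF assms, of "gradf (y k i)" "Suc k"] by simp
    also have "\<dots> \<le> (\<gamma> + L) / \<delta> * (t (Suc k) i / \<theta>)"
      using t_pos[OF assms, of "Suc k"] theta K
      by (intro mult_left_mono) (simp_all add: pos_le_divide_eq mult_left_le)
    finally show ?thesis .
  qed
  also have "\<dots> \<le> (\<gamma> + L) / \<delta> * (T (Suc k) / \<theta>)"
    using t_le_T[OF assms] theta K by (intro mult_left_mono divide_right_mono) auto
  finally show ?thesis
    by simp
qed

lemma intermediate_point_distance:
  assumes "m \<le> CARD('n)"
  shows "norm (y k (Suc m) - x k) \<le> real m * T (Suc k)"
  using assms
proof (induction m)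
  case 0
  then show ?case
    using y_start[of k] by simp
next
  case (Suc m)
  then have i: "Suc m \<in> {1..CARD('n)}"
    by simp
  have "norm (y k (Suc (Suc m)) - x k) \<le> norm (y k (Suc m) - x k) + norm (a k (Suc m) *\<^sub>R d (Suc k) (Suc m))"
    unfolding call(3)[OF i] using norm_triangle_ineq[of "y k (Suc m) - x k" "a k (Suc m) *\<^sub>R d (Suc k) (Suc m)"]
    by (simp add: algebra_simps)
  also have "\<dots> \<le> real m * T (Suc k) + T (Suc k)"
    using Suc step_le_T[OF i, of k] step_nonneg[OF i, of k] norm_direction[OF i, of "Suc k"] by simp
  finally show ?case
    by (simp add: algebra_simps)
qed

definition K :: real where "K = real CARD('n) * ((\<gamma> + L) / (\<delta> * \<theta>) + L * real CARD('n))"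

lemma K_pos: "0 < K"
proof -
  have "0 < (\<gamma> + L) / (\<delta> * \<theta>)"
    using gamma delta theta L_nonneg by simp
  moreover have "0 \<le> L * real CARD('n)"
    using L_nonneg by simp
  ultimately have "0 < (\<gamma> + L) / (\<delta> * \<theta>) + L * real CARD('n)"
    by (rule add_pos_nonneg)
  then show ?thesis
    unfolding K_def by (intro mult_pos_pos) auto
qed

text \<open>
  Component \<open>ix i\<close> of the gradient is controlled at \<open>y k i\<close>, not at \<open>x k\<close>. The displacement between
  the two points consists of steps that are themselves bounded by the next tentative steps, so moving
  all components to \<open>x k\<close> costs only another multiple of \<open>T (Suc k)\<close>.
\<close>
lemma gradient_le_next_step: "norm (gradf (x k)) \<le> K * T (Suc k)"
proof -
  have component: "\<bar>gradf (x k) $ j\<bar> \<le> ((\<gamma> + L) / (\<delta> * \<theta>) + L * real CARD('n)) * T (Suc k)" for j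
  proof -
    obtain i where i: "i \<in> {1..CARD('n)}" "ix i = j"
      using ix by (metis UNIV_I bij_betw_imp_surj_on imageE)
    then obtain m where m: "i = Suc m" "m \<le> CARD('n)"
      by (cases i) auto
    have "\<bar>(gradf (x k) - gradf (y k i)) $ j\<bar> \<le> L * norm (x k - y k i)"
      using component_le_norm_cart grad_lipschitz order_trans by blast
    also have "\<dots> \<le> L * (real CARD('n) * T (Suc k))"
    proof (intro mult_left_mono L_nonneg)
      have "norm (x k - y k i) \<le> real m * T (Suc k)"
        using intermediate_point_distance[OF m(2), of k] m(1) by (simp add: norm_minus_commute)
      also have "\<dots> \<le> real CARD('n) * T (Suc k)"
        using m(2) T_pos[of "Suc k"] by (intro mult_right_mono) auto
      finally show "norm (x k - y k i) \<le> real CARD('n) * T (Suc k)" .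
    qed
    finally show ?thesis
      using call_slope[OF i(1), of k] i(2) by (simp add: algebra_simps)
  qed
  have "norm (gradf (x k)) \<le> (\<Sum>j\<in>UNIV. \<bar>gradf (x k) $ j\<bar>)"
    by (rule norm_le_l1_cart)
  also have "\<dots> \<le> (\<Sum>j\<in>(UNIV :: 'n set). ((\<gamma> + L) / (\<delta> * \<theta>) + L * real CARD('n)) * T (Suc k))"
    by (intro sum_mono component)
  finally show ?thesis
    by (simp add: K_def)
qed

section \<open>The complexity bound\<close>

text \<open>
  The gradient bound says nothing about \<open>T 0\<close>. There \<open>\<epsilon> < 1\<close> lets the constant \<open>T 0\<close> dominate a
  multiple of \<open>\<epsilon>\<close>.
\<close>
lemma T_lower_bound:
  assumes "0 < \<epsilon>" "\<epsilon> < 1" "\<forall>k<j. \<epsilon> < norm (gradf (x k))" "k \<le> j"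
  shows "\<epsilon> * min (T 0) (1 / K) \<le> T k"
proof (cases k)
  case 0
  have "\<epsilon> * min (T 0) (1 / K) \<le> 1 * T 0"
    using assms T_pos[of 0] K_pos by (intro mult_mono) auto
  then show ?thesis
    using 0 by simp
next
  case (Suc l)
  then have "\<epsilon> < K * T k"
    using assms gradient_le_next_step[of l] by (metis Suc_le_lessD less_le_trans)
  then have "\<epsilon> * (1 / K) \<le> T k"
    using K_pos by (simp add: pos_divide_le_eq mult.commute)
  moreover have "\<epsilon> * min (T 0) (1 / K) \<le> \<epsilon> * (1 / K)"
    using assms(1) by (intro mult_left_mono) auto
  ultimately show ?thesis
    by simp
qed

lemma evaluation_complexity:
  obtains C where "\<And>\<epsilon> j. 0 < \<epsilon> \<Longrightarrow> \<epsilon> < 1 \<Longrightarrow> \<forall>k<j. \<epsilon> < norm (gradf (x k))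
    \<Longrightarrow> real (\<Sum>k\<le>j. \<Sum>i=1..CARD('n). N k i) \<le> C * \<epsilon> powi (-2)"
proof -
  obtain D where D: "\<And>j. (\<Sum>k\<le>j. (T k)\<^sup>2 * (\<Sum>i=1..CARD('n). N k i)) \<le> D"
    using weighted_evaluations_bounded by blast
  define \<tau> where "\<tau> = min (T 0) (1 / K)"
  have "0 < \<tau>"
    unfolding \<tau>_def using T_pos K_pos by simp
  have "real (\<Sum>k\<le>j. \<Sum>i=1..CARD('n). N k i) \<le> D / \<tau>\<^sup>2 * \<epsilon> powi (-2)"
    if \<epsilon>: "0 < \<epsilon>" "\<epsilon> < 1" "\<forall>k<j. \<epsilon> < norm (gradf (x k))" for \<epsilon> j
  proof -
    have "(\<epsilon> * \<tau>)\<^sup>2 * real (\<Sum>k\<le>j. \<Sum>i=1..CARD('n). N k i)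
        = (\<Sum>k\<le>j. (\<epsilon> * \<tau>)\<^sup>2 * real (\<Sum>i=1..CARD('n). N k i))"
      by (simp add: sum_distrib_left)
    also have "\<dots> \<le> (\<Sum>k\<le>j. (T k)\<^sup>2 * real (\<Sum>i=1..CARD('n). N k i))"
      using T_lower_bound[OF \<epsilon>] \<epsilon>(1) \<open>0 < \<tau>\<close>
      by (intro sum_mono mult_right_mono power_mono of_nat_0_le_iff) (auto simp: \<tau>_def[symmetric])
    also have "\<dots> \<le> D"
      by (rule D)
    finally have "real (\<Sum>k\<le>j. \<Sum>i=1..CARD('n). N k i) \<le> D / (\<epsilon> * \<tau>)\<^sup>2"
      using \<epsilon>(1) \<open>0 < \<tau>\<close> by (subst pos_le_divide_eq) (auto simp: mult.commute)
    then show ?thesis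
      by (simp add: power_int_minus power_mult_distrib field_simps)
  qed
  then show ?thesis
    using that by blast
qed

end

theorem proposition4p2:
  fixes f :: "real ^ 'n \<Rightarrow> real" and gradf :: "real ^ 'n \<Rightarrow> real ^ 'n"
    and L c \<theta> \<gamma> \<delta> :: real and ver :: df_version
    and ix :: "nat \<Rightarrow> 'n" and x\<^sub>0 :: "real ^ 'n" and t\<^sub>0 :: "nat \<Rightarrow> real"
    and x :: "nat \<Rightarrow> real ^ 'n" and t a :: "nat \<Rightarrow> nat \<Rightarrow> real"
    and d y :: "nat \<Rightarrow> nat \<Rightarrow> real ^ 'n" and N :: "nat \<Rightarrow> nat \<Rightarrow> nat"
  assumes grad: "\<And>z. GDERIV f z :> gradf z"
    and grad_cont: "continuous_on UNIV gradf"
    and grad_lipschitz: "\<And>u v. norm (gradf u - gradf v) \<le> L * norm (u - v)"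
    and bounded_below: "bdd_below (range f)"
    and c: "0 < c" "c < 1"
    and theta: "0 < \<theta>" "\<theta> < 1"
    and gamma: "0 < \<gamma>"
    and delta: "0 < \<delta>" "\<delta> < 1"
    and ix: "bij_betw ix {1..CARD('n)} UNIV"
    and t0_pos: "\<And>i. i \<in> {1..CARD('n)} \<Longrightarrow> 0 < t\<^sub>0 i"
    and run: "lam_run ver f \<gamma> \<delta> c \<theta> ix x\<^sub>0 t\<^sub>0 x t a d y N"
  shows "\<exists>C. \<forall>\<epsilon> jbar. 0 < \<epsilon> \<and> \<epsilon> < 1
      \<and> norm (gradf (x (Suc jbar))) \<le> \<epsilon> \<and> (\<forall>k\<le>jbar. \<epsilon> < norm (gradf (x k)))
    \<longrightarrow> real (\<Sum>k\<le>jbar. \<Sum>i=1..CARD('n). N k i) \<le> C * \<epsilon> powi (-2)"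
proof -
  interpret lam f gradf L \<gamma> \<delta> ver c \<theta> ix x\<^sub>0 t\<^sub>0 x t a d y N
    by unfold_locales (fact assms)+
  obtain C where "\<And>\<epsilon> j. 0 < \<epsilon> \<Longrightarrow> \<epsilon> < 1 \<Longrightarrow> \<forall>k<j. \<epsilon> < norm (gradf (x k))
      \<Longrightarrow> real (\<Sum>k\<le>j. \<Sum>i=1..CARD('n). N k i) \<le> C * \<epsilon> powi (-2)"
    using evaluation_complexity by blast
  then show ?thesis
    by (intro exI[of _ C]) auto
qed

end
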